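(* For each formula $\varphi\in\mathcal{L}_{\Box\Diamond}$: $\models_{\Pi\mathcal{G}}\varphi$ (i.e. $\varphi$ is valid in all $\Pi G$-models) if and only if $\varphi$ is valid in all (finite) $\Pi GF$-models $\langle W,\pi,T,e\rangle$ satisfying $|W|+|T|\le 2(\ell(\varphi)+2)$.
   Context: Fix a countable set $Var$ of propositional variables. $\mathcal{L}_{\Box\Diamond}$ is the set of formulas built from $Var$ and the constant $\bot$ with the binary connectives $\wedge,\to$ and the unary operators $\Box,\Diamond$ (other connectives are abbreviations). $\ell(\varphi)$ is the length of $\varphi$: the total number of occurrences of propositional variables, constants, connectives and modal operators in $\varphi$ (so $\ell(\varphi)=1$ for variables and $\bot$). On $[0,1]$ let $x\Rightarrow y = 1$ if $x\le y$ and $x\Rightarrow y=y$ otherwise. A $\Pi G$-model is a triple $\langle W,\pi,e\rangle$ with $W$ a non-empty set, $\pi:W\to[0,1]$ and $e:W\times Var\to[0,1]$ arbitrary maps. $e$ is extended to all formulas by $e(w,\bot)=0$, $e(w,\varphi\wedge\psi)=\min(e(w,\varphi),e(w,\psi))$, $e(w,\varphi\to\psi)=e(w,\varphi)\Rightarrow e(w,\psi)$, $e(w,\Box\varphi)=\inf_{w'\in W}\{\pi(w')\Rightarrow e(w',\varphi)\}$, $e(w,\Diamond\varphi)=\sup_{w'\in W}\{\min(\pi(w'),e(w',\varphi))\}$. A $\Pi GF$-model is a quadruple $\langle W,\pi,T,e\rangle$ where $\langle W,\pi,e\rangle$ is a $\Pi G$-model and $T$ is a finite set with $\{0,1\}\subseteq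 T\subseteq[0,1]$; here $e$ is extended to formulas with the same clauses for $\bot,\wedge,\to$, but with $e(w,\Box\varphi)=\max\{r\in T: r\le\inf_{w'\in W}\{\pi(w')\Rightarrow e(w',\varphi)\}\}$ and $e(w,\Diamond\varphi)=\min\{r\in T: r\ge\sup_{w'\in W}\{\min(\pi(w'),e(w',\varphi))\}\}$. In both cases $\varphi$ is valid in the model if $e(w,\varphi)=1$ for all $w\in W$. *)

theory Defs
  imports Complex_Main "HOL-Library.Countable"
begin

datatype 'p fm =
    Var 'p
  | Bot
  | And "'p fm" "'p fm"
  | Imp "'p fm" "'p fm"
  | Box "'p fm"
  | Dia "'p fm"

primrec fm_length :: "'p fm \<Rightarrow> nat" where
  "fm_length (Var p) = 1"
| "fm_length Bot = 1"
| "fm_length (And \<phi> \<psi>) = 1 + fm_length \<phi> + fm_length \<psi>"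
| "fm_length (Imp \<phi> \<psi>) = 1 + fm_length \<phi> + fm_length \<psi>"
| "fm_length (Box \<phi>) = 1 + fm_length \<phi>"
| "fm_length (Dia \<phi>) = 1 + fm_length \<phi>"

definition godel_imp :: "real \<Rightarrow> real \<Rightarrow> real" where
  "godel_imp x y = (if x \<le> y then 1 else y)"

(* A model lives on a set W of worlds inside a type 'w; the maps pi and e are total on 'w,
   but only their values on W are constrained or used. *)

definition PiG_model :: "'w set \<Rightarrow> ('w \<Rightarrow> real) \<Rightarrow> ('w \<Rightarrow> 'p \<Rightarrow> real) \<Rightarrow> bool" where
  "PiG_model W \<pi> e \<longleftrightarrow>
     W \<noteq> {} \<and> (\<forall>w\<in>W. \<pi> w \<in> {0..1}) \<and> (\<forall>w\<in>W. \<forall>p. e w p \<in> {0..1})"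

definition PiGF_model ::
    "'w set \<Rightarrow> ('w \<Rightarrow> real) \<Rightarrow> real set \<Rightarrow> ('w \<Rightarrow> 'p \<Rightarrow> real) \<Rightarrow> bool" where
  "PiGF_model W \<pi> T e \<longleftrightarrow>
     PiG_model W \<pi> e \<and> finite T \<and> {0, 1} \<subseteq> T \<and> T \<subseteq> {0..1}"

(* In a model, the sets under INF, SUP, Max and Min below are nonempty, and bounded
   respectively finite, so these operators have their intended meaning. *)

primrec PiG_eval ::
    "'w set \<Rightarrow> ('w \<Rightarrow> real) \<Rightarrow> ('w \<Rightarrow> 'p \<Rightarrow> real) \<Rightarrow> 'w \<Rightarrow> 'p fm \<Rightarrow> real" where
  "PiG_eval W \<pi> e w (Var p) = e w p"
| "PiG_eval W \<pi> e w Bot = 0"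
| "PiG_eval W \<pi> e w (And \<phi> \<psi>) = min (PiG_eval W \<pi> e w \<phi>) (PiG_eval W \<pi> e w \<psi>)"
| "PiG_eval W \<pi> e w (Imp \<phi> \<psi>) = godel_imp (PiG_eval W \<pi> e w \<phi>) (PiG_eval W \<pi> e w \<psi>)"
| "PiG_eval W \<pi> e w (Box \<phi>) = (INF w'\<in>W. godel_imp (\<pi> w') (PiG_eval W \<pi> e w' \<phi>))"
| "PiG_eval W \<pi> e w (Dia \<phi>) = (SUP w'\<in>W. min (\<pi> w') (PiG_eval W \<pi> e w' \<phi>))"

primrec PiGF_eval ::
    "'w set \<Rightarrow> ('w \<Rightarrow> real) \<Rightarrow> real set \<Rightarrow> ('w \<Rightarrow> 'p \<Rightarrow> real) \<Rightarrow> 'w \<Rightarrow> 'p fm \<Rightarrow> real" where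
  "PiGF_eval W \<pi> T e w (Var p) = e w p"
| "PiGF_eval W \<pi> T e w Bot = 0"
| "PiGF_eval W \<pi> T e w (And \<phi> \<psi>) = min (PiGF_eval W \<pi> T e w \<phi>) (PiGF_eval W \<pi> T e w \<psi>)"
| "PiGF_eval W \<pi> T e w (Imp \<phi> \<psi>) = godel_imp (PiGF_eval W \<pi> T e w \<phi>) (PiGF_eval W \<pi> T e w \<psi>)"
| "PiGF_eval W \<pi> T e w (Box \<phi>) =
     Max {r \<in> T. r \<le> (INF w'\<in>W. godel_imp (\<pi> w') (PiGF_eval W \<pi> T e w' \<phi>))}"
| "PiGF_eval W \<pi> T e w (Dia \<phi>) =
     Min {r \<in> T. r \<ge> (SUP w'\<in>W. min (\<pi> w') (PiGF_eval W \<pi> T e w' \<phi>))}"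

definition PiG_valid ::
    "'w set \<Rightarrow> ('w \<Rightarrow> real) \<Rightarrow> ('w \<Rightarrow> 'p \<Rightarrow> real) \<Rightarrow> 'p fm \<Rightarrow> bool" where
  "PiG_valid W \<pi> e \<phi> \<longleftrightarrow> (\<forall>w\<in>W. PiG_eval W \<pi> e w \<phi> = 1)"

definition PiGF_valid ::
    "'w set \<Rightarrow> ('w \<Rightarrow> real) \<Rightarrow> real set \<Rightarrow> ('w \<Rightarrow> 'p \<Rightarrow> real) \<Rightarrow> 'p fm \<Rightarrow> bool" where
  "PiGF_valid W \<pi> T e \<phi> \<longleftrightarrow> (\<forall>w\<in>W. PiGF_eval W \<pi> T e w \<phi> = 1)"

(* HOL cannot quantify over all sets W at once, so truth in all models is expressed relative
   to a type 'w from which the worlds are drawn. Claims about it should be stated for an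
   arbitrary infinite 'w: every set of worlds sits inside some infinite type, whereas in a
   finite type the models would be of bounded size. *)

definition PiG_tautology :: "'w itself \<Rightarrow> 'p fm \<Rightarrow> bool" where
  "PiG_tautology TYPE('w) \<phi> \<longleftrightarrow>
     (\<forall>(W :: 'w set) \<pi> e. PiG_model W \<pi> e \<longrightarrow> PiG_valid W \<pi> e \<phi>)"

end

theory Submission
  imports Defs "HOL-Library.Countable_Set"
begin

text \<open>
  From a \<open>\<Pi>G\<close>-countermodel one obtains a small \<open>\<Pi>GF\<close>-countermodel by taking for \<open>T\<close> the values
  (world-independent) of the modal subformulas and keeping one world per modal subformula, close
  enough to the infimum or supremum not to be separated from it by \<open>T\<close>. Conversely, given a
  \<open>\<Pi>GF\<close>-countermodel, one takes countably many copies of every world, each distorted by an order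
  embedding of \<open>[0,1]\<close> that fixes \<open>T\<close>. Distortions commute with the Goedel connectives and can push
  all values strictly between two neighbours of \<open>T\<close> arbitrarily close to either of them, so that
  genuine infima and suprema become the rounded ones.
\<close>

section \<open>Evaluation and reindexing of models\<close>

lemma INF_unit_le:
  assumes "\<forall>w\<in>W. f w \<in> {0..1::real}" "w \<in> W"
  shows "(INF w\<in>W. f w) \<le> f w"
  using assms by (intro cINF_lower bdd_belowI2[where m=0]) auto

lemma le_SUP_unit:
  assumes "\<forall>w\<in>W. f w \<in> {0..1::real}" "w \<in> W"
  shows "f w \<le> (SUP w\<in>W. f w)"
  using assms by (intro cSUP_upper bdd_aboveI2[where M=1]) auto

lemma INF_unit_range:
  assumes "\<forall>w\<in>W. f w \<in> {0..1::real}" "W \<noteq> {}"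
  shows "(INF w\<in>W. f w) \<in> {0..1}"
proof -
  obtain w where w: "w \<in> W" using assms by blast
  have "(INF w\<in>W. f w) \<le> f w" by (rule INF_unit_le) fact+
  moreover have "0 \<le> (INF w\<in>W. f w)" using assms by (intro cINF_greatest) auto
  ultimately show ?thesis using assms(1) w by fastforce
qed

lemma SUP_unit_range:
  assumes "\<forall>w\<in>W. f w \<in> {0..1::real}" "W \<noteq> {}"
  shows "(SUP w\<in>W. f w) \<in> {0..1}"
proof -
  obtain w where w: "w \<in> W" using assms by blast
  have "f w \<le> (SUP w\<in>W. f w)" by (rule le_SUP_unit) fact+
  moreover have "(SUP w\<in>W. f w) \<le> 1" using assms by (intro cSUP_least) auto
  ultimately show ?thesis using assms(1) w by fastforce
qed

lemma godel_imp_range: "y \<in> {0..1} \<Longrightarrow> godel_imp x y \<in> {0..1}"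
  by (simp add: godel_imp_def)

lemma min_range: "x \<in> {0..1} \<Longrightarrow> y \<in> {0..1} \<Longrightarrow> min x y \<in> {0..1::real}"
  by (auto simp: min_def)

lemma PiG_eval_range:
  assumes "PiG_model W \<pi> e" "w \<in> W"
  shows "PiG_eval W \<pi> e w \<phi> \<in> {0..1}"
  using assms(2)
proof (induction \<phi> arbitrary: w)
  case (Var p) then show ?case using assms(1) by (simp add: PiG_model_def)
next
  case (And \<phi> \<psi>) then show ?case unfolding PiG_eval.simps by (blast intro: min_range)
next
  case (Imp \<phi> \<psi>) then show ?case unfolding PiG_eval.simps by (blast intro: godel_imp_range)
next
  case (Box \<phi>)
  then show ?case using assms(1) unfolding PiG_eval.simps
    by (intro INF_unit_range) (blast intro: godel_imp_range, auto)
next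
  case (Dia \<phi>)
  then show ?case using assms(1) unfolding PiG_eval.simps PiG_model_def
    by (intro SUP_unit_range) (blast intro: min_range, auto)
qed auto

text \<open>The modal clauses see only the set of values over all worlds, so a world may be listed
  several times under different names. This is the tool for moving models between types of
  worlds.\<close>

lemma PiG_eval_reindex:
  "PiG_eval U (\<pi> \<circ> g) (e \<circ> g) u \<phi> = PiG_eval (g ` U) \<pi> e (g u) \<phi>"
  by (induction \<phi> arbitrary: u) (simp_all add: image_image)

lemma PiGF_eval_reindex:
  "PiGF_eval U (\<pi> \<circ> g) T (e \<circ> g) u \<phi> = PiGF_eval (g ` U) \<pi> T e (g u) \<phi>"
  by (induction \<phi> arbitrary: u) (simp_all add: image_image)

lemma PiG_model_reindex:
  "PiG_model (g ` U) \<pi> e \<Longrightarrow> PiG_model U (\<pi> \<circ> g) (e \<circ> g)"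
  by (auto simp: PiG_model_def)


section \<open>From \<open>\<Pi>G\<close>-models to small \<open>\<Pi>GF\<close>-models\<close>

text \<open>The values of these formulas become the thresholds in \<open>T\<close>, and one world is
  kept for each of them; hence a set, counted without repetitions.\<close>

primrec modal_subfms :: "'p fm \<Rightarrow> 'p fm set" where
  "modal_subfms (Var p) = {}"
| "modal_subfms Bot = {}"
| "modal_subfms (And \<phi> \<psi>) = modal_subfms \<phi> \<union> modal_subfms \<psi>"
| "modal_subfms (Imp \<phi> \<psi>) = modal_subfms \<phi> \<union> modal_subfms \<psi>"
| "modal_subfms (Box \<phi>) = insert (Box \<phi>) (modal_subfms \<phi>)"
| "modal_subfms (Dia \<phi>) = insert (Dia \<phi>) (modal_subfms \<phi>)"

lemma finite_modal_subfms: "finite (modal_subfms \<phi>)"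
  by (induction \<phi>) auto

text \<open>Distinct modal subformulas are charged to distinct modal operators; the inequality is
  strict because every formula also contains an atom.\<close>

lemma card_modal_subfms: "card (modal_subfms \<phi>) < fm_length \<phi>"
proof (induction \<phi>)
  case (And \<phi> \<psi>)
  then show ?case using card_Un_le[of "modal_subfms \<phi>" "modal_subfms \<psi>"] by simp
next
  case (Imp \<phi> \<psi>)
  then show ?case using card_Un_le[of "modal_subfms \<phi>" "modal_subfms \<psi>"] by simp
qed (auto simp: card_insert_if finite_modal_subfms)

section \<open>Witnessing worlds and restriction to them\<close>

text \<open>As \<open>T\<close> is finite, there is a least \<open>s\<close> in \<open>T\<close>
  above the infimum, if any. It is not a lower bound, so some value lies below \<open>s\<close> and
  thus below all such \<open>t\<close>.\<close>

lemma INF_witness: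
  fixes f :: "'w \<Rightarrow> real"
  assumes "finite T" "W \<noteq> {}"
  shows "\<exists>w\<in>W. \<forall>t\<in>T. (INF v\<in>W. f v) < t \<longrightarrow> f w < t"
proof (cases "{t\<in>T. (INF v\<in>W. f v) < t} = {}")
  case True
  then show ?thesis using assms(2) by blast
next
  case False
  define s where "s = Min {t\<in>T. (INF v\<in>W. f v) < t}"
  have "s \<in> {t\<in>T. (INF v\<in>W. f v) < t}" unfolding s_def using False assms(1) by (intro Min_in) auto
  then have "\<not> (\<forall>w\<in>W. s \<le> f w)" using cINF_greatest[OF assms(2), of s f] by auto
  then obtain w where "w \<in> W" "f w < s" by (auto simp: not_le)
  moreover have "s \<le> t" if "t \<in> T" "(INF v\<in>W. f v) < t" for t
    unfolding s_def using that assms(1) by (intro Min_le) auto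
  ultimately show ?thesis by (meson less_le_trans)
qed

lemma SUP_witness:
  fixes f :: "'w \<Rightarrow> real"
  assumes "finite T" "W \<noteq> {}"
  shows "\<exists>w\<in>W. \<forall>t\<in>T. t < (SUP v\<in>W. f v) \<longrightarrow> t < f w"
proof (cases "{t\<in>T. t < (SUP v\<in>W. f v)} = {}")
  case True
  then show ?thesis using assms(2) by blast
next
  case False
  define s where "s = Max {t\<in>T. t < (SUP v\<in>W. f v)}"
  have "s \<in> {t\<in>T. t < (SUP v\<in>W. f v)}" unfolding s_def using False assms(1) by (intro Max_in) auto
  then have "\<not> (\<forall>w\<in>W. f w \<le> s)" using cSUP_least[OF assms(2), of f s] by auto
  then obtain w where "w \<in> W" "s < f w" by (auto simp: not_le)
  moreover have "t \<le> s" if "t \<in> T" "t < (SUP v\<in>W. f v)" for t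
    unfolding s_def using that assms(1) by (intro Max_ge) auto
  ultimately show ?thesis by (meson le_less_trans)
qed

text \<open>The world \<open>w\<close> realises the infimum or supremum up to the resolution of
  \<open>T\<close>. The trivial last clause lets one choice function serve all formulas.\<close>

fun modal_witness ::
    "'w set \<Rightarrow> ('w \<Rightarrow> real) \<Rightarrow> real set \<Rightarrow> ('w \<Rightarrow> 'p \<Rightarrow> real) \<Rightarrow> 'p fm \<Rightarrow> 'w \<Rightarrow> bool" where
  "modal_witness W \<pi> T e (Box \<psi>) w \<longleftrightarrow> (\<forall>t\<in>T. PiG_eval W \<pi> e w (Box \<psi>) < t
     \<longrightarrow> godel_imp (\<pi> w) (PiG_eval W \<pi> e w \<psi>) < t)"
| "modal_witness W \<pi> T e (Dia \<psi>) w \<longleftrightarrow> (\<forall>t\<in>T. t < PiG_eval W \<pi> e w (Dia \<psi>)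
     \<longrightarrow> t < min (\<pi> w) (PiG_eval W \<pi> e w \<psi>))"
| "modal_witness W \<pi> T e _ w \<longleftrightarrow> True"

lemma modal_witness_exists:
  assumes "finite T" "W \<noteq> {}"
  shows "\<exists>w\<in>W. modal_witness W \<pi> T e \<chi> w"
proof (cases \<chi>)
  case (Box \<psi>)
  then show ?thesis
    using INF_witness[OF assms, of "\<lambda>v. godel_imp (\<pi> v) (PiG_eval W \<pi> e v \<psi>)"] by simp
next
  case (Dia \<psi>)
  then show ?thesis
    using SUP_witness[OF assms, of "\<lambda>v. min (\<pi> v) (PiG_eval W \<pi> e v \<psi>)"] by simp
qed (use assms in auto)

text \<open>Shrinking \<open>W\<close> to \<open>V\<close> can only raise an infimum, but the
  witness in \<open>V\<close> keeps it below every element of \<open>T\<close> above the old value.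
  As the old value is itself in \<open>T\<close>, rounding down restores it exactly. Suprema are
  dual.\<close>

lemma PiGF_eval_submodel:
  assumes M: "PiG_model W \<pi> e" and "finite T" and "V \<subseteq> W"
    and T: "\<forall>\<chi>\<in>S. \<forall>w\<in>W. PiG_eval W \<pi> e w \<chi> \<in> T"
    and V: "\<forall>\<chi>\<in>S. \<exists>v\<in>V. modal_witness W \<pi> T e \<chi> v"
    and "modal_subfms \<psi> \<subseteq> S" "w \<in> V"
  shows "PiGF_eval V \<pi> T e w \<psi> = PiG_eval W \<pi> e w \<psi>"
  using assms(6,7)
proof (induction \<psi> arbitrary: w)
  case (Box \<psi>)
  let ?f = "\<lambda>v. godel_imp (\<pi> v) (PiG_eval W \<pi> e v \<psi>)"
  define a where "a = (INF v\<in>W. ?f v)"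
  have f: "\<forall>v\<in>W. ?f v \<in> {0..1}" using PiG_eval_range[OF M] godel_imp_range by blast
  have fV: "\<forall>v\<in>V. ?f v \<in> {0..1}" using f \<open>V \<subseteq> W\<close> by blast
  have IH: "(INF v\<in>V. godel_imp (\<pi> v) (PiGF_eval V \<pi> T e v \<psi>)) = (INF v\<in>V. ?f v)"
    using Box by (intro INF_cong) auto
  have "Box \<psi> \<in> S" "w \<in> W" using Box.prems \<open>V \<subseteq> W\<close> by auto
  then have "PiG_eval W \<pi> e w (Box \<psi>) \<in> T" using T by blast
  then have "a \<in> T" by (simp add: a_def)
  obtain v where v: "v \<in> V" "\<forall>t\<in>T. a < t \<longrightarrow> ?f v < t"
    using bspec[OF V \<open>Box \<psi> \<in> S\<close>] by (auto simp: a_def)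
  have "(INF v\<in>V. ?f v) \<le> ?f v" by (rule INF_unit_le[OF fV v(1)])
  moreover have "a \<le> (INF v\<in>V. ?f v)"
    using Box.prems(2) \<open>V \<subseteq> W\<close> unfolding a_def
    by (intro cINF_greatest INF_unit_le[OF f]) auto
  ultimately have "Max {r\<in>T. r \<le> (INF v\<in>V. ?f v)} = a"
    using \<open>a \<in> T\<close> \<open>finite T\<close> v(2) by (intro Max_eqI) (auto intro: leI)
  then show ?case by (simp add: IH a_def)
next
  case (Dia \<psi>)
  let ?f = "\<lambda>v. min (\<pi> v) (PiG_eval W \<pi> e v \<psi>)"
  define a where "a = (SUP v\<in>W. ?f v)"
  have f: "\<forall>v\<in>W. ?f v \<in> {0..1}"
    using PiG_eval_range[OF M] M min_range unfolding PiG_model_def by blast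
  have fV: "\<forall>v\<in>V. ?f v \<in> {0..1}" using f \<open>V \<subseteq> W\<close> by blast
  have IH: "(SUP v\<in>V. min (\<pi> v) (PiGF_eval V \<pi> T e v \<psi>)) = (SUP v\<in>V. ?f v)"
    using Dia by (intro SUP_cong) auto
  have "Dia \<psi> \<in> S" "w \<in> W" using Dia.prems \<open>V \<subseteq> W\<close> by auto
  then have "PiG_eval W \<pi> e w (Dia \<psi>) \<in> T" using T by blast
  then have "a \<in> T" by (simp add: a_def)
  obtain v where v: "v \<in> V" "\<forall>t\<in>T. t < a \<longrightarrow> t < ?f v"
    using bspec[OF V \<open>Dia \<psi> \<in> S\<close>] by (auto simp: a_def)
  have "?f v \<le> (SUP v\<in>V. ?f v)" by (rule le_SUP_unit[OF fV v(1)])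
  moreover have "(SUP v\<in>V. ?f v) \<le> a"
    using Dia.prems(2) \<open>V \<subseteq> W\<close> unfolding a_def
    by (intro cSUP_least le_SUP_unit[OF f]) auto
  ultimately have "Min {r\<in>T. r \<ge> (SUP v\<in>V. ?f v)} = a"
    using \<open>a \<in> T\<close> \<open>finite T\<close> v(2) by (intro Min_eqI) (auto intro: leI)
  then show ?case by (simp add: IH a_def)
qed auto

lemma small_PiGF_countermodel:
  fixes W :: "'w set" and \<phi> :: "'p fm"
  assumes M: "PiG_model W \<pi> e" and w0: "w0 \<in> W"
  obtains V T where "V \<subseteq> W" "finite V" "w0 \<in> V" "PiGF_model V \<pi> T e"
    "card V + card T \<le> 2 * (fm_length \<phi> + 2)"
    "PiGF_eval V \<pi> T e w0 \<phi> = PiG_eval W \<pi> e w0 \<phi>"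
proof -
  define S where "S = modal_subfms \<phi>"
  \<comment> \<open>Sampling at \<open>w0\<close> suffices: the clauses for \<open>Box\<close> and
    \<open>Dia\<close> do not mention the current world, which is \<open>const\<close>
    below.\<close>
  define T where "T = {0, 1} \<union> PiG_eval W \<pi> e w0 ` S"
  have S: "finite S" "card S < fm_length \<phi>"
    unfolding S_def by (rule finite_modal_subfms, rule card_modal_subfms)
  then have "finite T" by (simp add: T_def)
  obtain wit where wit: "wit \<chi> \<in> W" "modal_witness W \<pi> T e \<chi> (wit \<chi>)" for \<chi>
    using modal_witness_exists[OF \<open>finite T\<close>, of W \<pi> e] w0 by (metis empty_iff)
  define V where "V = insert w0 (wit ` S)"
  have V: "V \<subseteq> W" "finite V" "w0 \<in> V" using wit w0 S by (auto simp: V_def)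
  have const: "PiG_eval W \<pi> e w \<chi> = PiG_eval W \<pi> e w0 \<chi>" if "\<chi> \<in> modal_subfms \<psi>" for w \<chi> and \<psi> :: "'p fm"
    using that by (induction \<psi>) auto
  have "card V \<le> 1 + card S"
    using card_insert_le_m1[of "1 + card S" "wit ` S" w0] card_image_le[OF S(1), of wit]
    by (simp add: V_def)
  moreover have "card T \<le> 2 + card S"
    using card_Un_le[of "{0,1::real}" "PiG_eval W \<pi> e w0 ` S"] card_image_le[OF S(1), of "PiG_eval W \<pi> e w0"]
    by (simp add: T_def)
  \<comment> \<open>The sum is at most \<open>3 + 2 * card S\<close>, where
    \<open>card S < fm_length \<phi>\<close>.\<close>
  ultimately have size: "card V + card T \<le> 2 * (fm_length \<phi> + 2)" using S(2) by arith
  have model: "PiGF_model V \<pi> T e"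
    using M V \<open>finite T\<close> PiG_eval_range[OF M w0]
    unfolding PiGF_model_def PiG_model_def T_def by auto
  have "PiG_eval W \<pi> e w \<chi> \<in> T" if "\<chi> \<in> S" for w \<chi>
    using const[of \<chi> \<phi> w] that unfolding T_def S_def by blast
  moreover have "\<exists>v\<in>V. modal_witness W \<pi> T e \<chi> v" if "\<chi> \<in> S" for \<chi>
    using wit(2)[of \<chi>] that unfolding V_def by blast
  ultimately have "PiGF_eval V \<pi> T e w0 \<phi> = PiG_eval W \<pi> e w0 \<phi>"
    using V(3) by (intro PiGF_eval_submodel[OF M \<open>finite T\<close> V(1), of S]) (auto simp: S_def)
  then show ?thesis using that V size model by simp
qed


section \<open>From \<open>\<Pi>GF\<close>-models to \<open>\<Pi>G\<close>-models\<close>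

text \<open>After cross-multiplication the difference of the two sides is
  \<open>k * ((y - x) * (b - a))\<close>. The map takes \<open>a\<close> to 0 and \<open>b\<close>
  to 1; large \<open>k\<close> pushes interior points towards 0, small \<open>k\<close> towards
  1.\<close>

lemma moebius_strict_mono:
  fixes a b k x y :: real
  assumes "a \<le> x" "x < y" "y \<le> b" "0 < k"
  shows "(x - a) / ((x - a) + k * (b - x)) < (y - a) / ((y - a) + k * (b - y))"
proof -
  have 1: "0 < (x - a) + k * (b - x)" using assms by (intro add_nonneg_pos) auto
  have 2: "0 < (y - a) + k * (b - y)" using assms by (intro add_pos_nonneg) auto
  have "0 < k * ((y - x) * (b - a))" using assms by simp
  also have "\<dots> = (y - a) * ((x - a) + k * (b - x)) - (x - a) * ((y - a) + k * (b - y))"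
    by (simp add: algebra_simps)
  finally show ?thesis using 1 2 by (simp add: frac_less_eq divide_less_eq less_divide_eq mult.commute)
qed

section \<open>Rounding to \<open>T\<close> and the stretching maps\<close>

locale grid =
  fixes T :: "real set"
  assumes finite_T: "finite T" and ends: "0 \<in> T" "1 \<in> T" and T_unit: "T \<subseteq> {0..1}"
begin

text \<open>These are verbatim the roundings in \<open>PiGF_eval\<close>, so that its modal clauses
  fold into them. The sets are nonempty for \<open>0 \<le> x\<close> and \<open>x \<le> 1\<close>
  respectively, as 0 and 1 are in \<open>T\<close>.\<close>

definition lower :: "real \<Rightarrow> real" where "lower x = Max {r\<in>T. r \<le> x}"
definition upper :: "real \<Rightarrow> real" where "upper x = Min {r\<in>T. r \<ge> x}"

lemma lower:
  assumes "0 \<le> x"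
  shows "lower x \<in> T" "lower x \<le> x"
proof -
  have "lower x \<in> {r\<in>T. r \<le> x}"
    unfolding lower_def using assms finite_T ends by (intro Max_in) auto
  then show "lower x \<in> T" "lower x \<le> x" by auto
qed

lemma upper:
  assumes "x \<le> 1"
  shows "upper x \<in> T" "x \<le> upper x"
proof -
  have "upper x \<in> {r\<in>T. r \<ge> x}"
    unfolding upper_def using assms finite_T ends by (intro Min_in) auto
  then show "upper x \<in> T" "x \<le> upper x" by auto
qed

lemma lower_greatest: "t \<in> T \<Longrightarrow> t \<le> x \<Longrightarrow> t \<le> lower x"
  unfolding lower_def using finite_T by (intro Max_ge) auto

lemma upper_least: "t \<in> T \<Longrightarrow> x \<le> t \<Longrightarrow> upper x \<le> t"
  unfolding upper_def using finite_T by (intro Min_le) auto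

lemma lower_fix: "t \<in> T \<Longrightarrow> lower t = t"
  using lower(2)[of t] lower_greatest[of t t] T_unit by force

lemma upper_fix: "t \<in> T \<Longrightarrow> upper t = t"
  using upper(2)[of t] upper_least[of t t] T_unit by force

lemma lower_less: "x \<in> {0..1} \<Longrightarrow> x \<notin> T \<Longrightarrow> lower x < x"
  using lower[of x] by (auto simp: less_le)

lemma upper_greater: "x \<in> {0..1} \<Longrightarrow> x \<notin> T \<Longrightarrow> x < upper x"
  using upper[of x] by (auto simp: less_le)

text \<open>Between neighbours of \<open>T\<close> this is a Moebius map fixing both of them. On \<open>T\<close> itself the quotient
  is \<open>0 / 0 = 0\<close>, so that points of \<open>T\<close> are fixed.\<close>

definition stretch :: "real \<Rightarrow> real \<Rightarrow> real" where
  "stretch k x = lower x +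
     (upper x - lower x) * ((x - lower x) / ((x - lower x) + k * (upper x - x)))"

lemma stretch_fix: "t \<in> T \<Longrightarrow> stretch k t = t"
  by (simp add: stretch_def lower_fix upper_fix)

text \<open>Strict monotonicity of the Moebius quotient, compared with its values 0 and 1 at the two
  neighbours of \<open>x\<close>.\<close>

lemma stretch_between:
  assumes "x \<in> {0..1}" "x \<notin> T" "0 < k"
  shows "lower x < stretch k x" "stretch k x < upper x"
proof -
  define a b where "a = lower x" and "b = upper x"
  have ab: "a < x" "x < b" using lower_less upper_greater assms by (auto simp: a_def b_def)
  have "0 < (x - a) / ((x - a) + k * (b - x))"
    using moebius_strict_mono[of a a x b k] ab assms by simp
  moreover have "(x - a) / ((x - a) + k * (b - x)) < 1"
    using moebius_strict_mono[of a x b b k] ab assms by simp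
  ultimately have "0 < (b - a) * ((x - a) / ((x - a) + k * (b - x)))"
    "(b - a) * ((x - a) / ((x - a) + k * (b - x))) < (b - a) * 1"
    using ab by (intro mult_pos_pos mult_strict_left_mono; simp)+
  then show "lower x < stretch k x" "stretch k x < upper x"
    unfolding stretch_def a_def[symmetric] b_def[symmetric] by auto
qed

lemma stretch_bounds:
  assumes "x \<in> {0..1}" "0 < k"
  shows "lower x \<le> stretch k x" "stretch k x \<le> upper x"
  using stretch_between[of x k] assms
  by (cases "x \<in> T"; simp add: stretch_fix lower_fix upper_fix less_imp_le)+

lemma stretch_range:
  assumes "x \<in> {0..1}" "0 < k"
  shows "stretch k x \<in> {0..1}"
  using stretch_bounds[OF assms] lower(1)[of x] upper(1)[of x] assms T_unit
  by (auto simp: subset_iff intro: order_trans)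

text \<open>If a point of \<open>T\<close> lies between \<open>x\<close> and \<open>y\<close>, it
  separates the images, strictly unless both arguments are fixed points. Otherwise \<open>x\<close>
  and \<open>y\<close> have the same neighbours, and one Moebius map acts on both.\<close>

lemma stretch_strict_mono:
  assumes x: "x \<in> {0..1}" and y: "y \<in> {0..1}" and "x < y" and k: "0 < k"
  shows "stretch k x < stretch k y"
proof (cases "upper x \<le> y")
  case True
  then have *: "upper x \<le> lower y" using upper(1)[of x] x lower_greatest by auto
  show ?thesis
  proof (cases "x \<in> T \<and> y \<in> T")
    case True
    then show ?thesis using \<open>x < y\<close> by (simp add: stretch_fix)
  next
    case False
    then show ?thesis
      using * stretch_between[OF x _ k] stretch_between[OF y _ k]
        stretch_bounds[OF x k] stretch_bounds[OF y k] by fastforce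
  qed
next
  case False
  have "lower y \<le> lower x"
  proof -
    have "lower y \<le> y" "lower y \<in> T" using lower y by auto
    then have "lower y \<le> x" using False upper_least[of "lower y" x] by linarith
    then show ?thesis using \<open>lower y \<in> T\<close> lower_greatest by blast
  qed
  moreover have "lower x \<le> lower y"
    using lower[of x] x \<open>x < y\<close> lower_greatest[of "lower x" y] by auto
  moreover have "upper y \<le> upper x" using False upper[of x] x upper_least[of "upper x" y] by auto
  moreover have "upper x \<le> upper y"
    using upper[of y] y \<open>x < y\<close> upper_least[of "upper y" x] by auto
  ultimately have eq: "lower y = lower x" "upper y = upper x" by auto
  have ab: "lower x \<le> x" "y < upper x" using lower x False by auto
  then show ?thesis
    unfolding stretch_def eq using \<open>x < y\<close> k
    by (intro add_strict_left_mono mult_strict_left_mono moebius_strict_mono) auto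
qed

lemma stretch_mono:
  assumes "x \<in> {0..1}" "y \<in> {0..1}" "x \<le> y" "0 < k"
  shows "stretch k x \<le> stretch k y"
  using stretch_strict_mono[of x y k] assms by (cases "x = y") auto

lemma stretch_le_iff:
  assumes "x \<in> {0..1}" "y \<in> {0..1}" "0 < k"
  shows "stretch k x \<le> stretch k y \<longleftrightarrow> x \<le> y"
  using stretch_strict_mono[of y x k] stretch_mono[of x y k] assms by fastforce

lemma stretch_min:
  assumes "x \<in> {0..1}" "y \<in> {0..1}" "0 < k"
  shows "min (stretch k x) (stretch k y) = stretch k (min x y)"
  using stretch_le_iff[OF assms] by (simp add: min_def)

text \<open>\<open>godel_imp\<close> depends only on the order of its arguments and on the constant
  1, which is in \<open>T\<close> and hence fixed.\<close>

lemma stretch_godel_imp: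
  assumes "x \<in> {0..1}" "y \<in> {0..1}" "0 < k"
  shows "godel_imp (stretch k x) (stretch k y) = stretch k (godel_imp x y)"
  using stretch_le_iff[OF assms] by (simp add: godel_imp_def stretch_fix ends)

section \<open>Infima and suprema of stretched values\<close>

text \<open>The positive rationals, indexed by pairs: a countable supply of parameters, both
  arbitrarily large and arbitrarily small. Countability lets the copies fit into any infinite
  type.\<close>

definition ratio :: "nat \<times> nat \<Rightarrow> real" where
  "ratio q = real (Suc (fst q)) / real (Suc (snd q))"

lemma ratio_pos: "0 < ratio q"
  by (simp add: ratio_def)

text \<open>The excess over \<open>a\<close> is less than
  \<open>(b - a) * (x - a) / (k * (b - x))\<close>, which tends to 0 as \<open>k\<close> grows;
  \<open>k\<close> is \<open>n + 1\<close> here.\<close>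

lemma stretch_near_lower:
  assumes x: "x \<in> {0..1}" and "0 < \<epsilon>"
  shows "\<exists>q. stretch (ratio q) x < lower x + \<epsilon>"
proof (cases "x \<in> T")
  case True
  then show ?thesis using \<open>0 < \<epsilon>\<close> by (simp add: stretch_fix lower_fix)
next
  case False
  define a b where "a = lower x" and "b = upper x"
  have ab: "a < x" "x < b" using lower_less upper_greater x False by (auto simp: a_def b_def)
  obtain n where n: "(b - a) * (x - a) / (\<epsilon> * (b - x)) < real n" using reals_Archimedean2 by blast
  define k where "k = ratio (n, 0)"
  have "(b - a) * (x - a) / (\<epsilon> * (b - x)) < k" using n by (simp add: k_def ratio_def)
  then have "(b - a) * (x - a) < \<epsilon> * (k * (b - x))"
    using ab \<open>0 < \<epsilon>\<close> by (simp add: divide_less_eq mult_ac)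
  also have "\<dots> \<le> \<epsilon> * ((x - a) + k * (b - x))" using ab \<open>0 < \<epsilon>\<close> by simp
  finally have "(b - a) * ((x - a) / ((x - a) + k * (b - x))) < \<epsilon>"
    using ab ratio_pos[of "(n, 0)"] by (simp add: divide_less_eq add_pos_pos k_def[symmetric])
  then show ?thesis
    unfolding stretch_def a_def[symmetric] b_def[symmetric] k_def by (intro exI[of _ "(n, 0)"]) simp
qed

text \<open>The gap below \<open>b\<close> is less than
  \<open>(b - a) * k * (b - x) / (x - a)\<close>, which tends to 0 with \<open>k\<close>;
  \<open>k\<close> is \<open>1 / (n + 1)\<close> here.\<close>

lemma stretch_near_upper:
  assumes x: "x \<in> {0..1}" and "0 < \<epsilon>"
  shows "\<exists>q. upper x - \<epsilon> < stretch (ratio q) x"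
proof (cases "x \<in> T")
  case True
  then show ?thesis using \<open>0 < \<epsilon>\<close> by (simp add: stretch_fix upper_fix)
next
  case False
  define a b where "a = lower x" and "b = upper x"
  have ab: "a < x" "x < b" using lower_less upper_greater x False by (auto simp: a_def b_def)
  obtain n where n: "(b - a) * (b - x) / (\<epsilon> * (x - a)) < real n" using reals_Archimedean2 by blast
  define k where "k = ratio (0, n)"
  have k: "0 < k" using ratio_pos by (simp add: k_def)
  have "(b - a) * (b - x) / (\<epsilon> * (x - a)) < 1 / k" using n by (simp add: k_def ratio_def)
  then have "(b - a) * (k * (b - x)) < \<epsilon> * (x - a)"
    using ab \<open>0 < \<epsilon>\<close> k by (simp add: divide_less_eq less_divide_eq mult_ac)
  also have "\<dots> \<le> \<epsilon> * ((x - a) + k * (b - x))" using ab \<open>0 < \<epsilon>\<close> k by simp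
  finally have 1: "(b - a) * (k * (b - x)) < \<epsilon> * ((x - a) + k * (b - x))" .
  have "0 < (x - a) + k * (b - x)" using ab k by (simp add: add_pos_pos)
  then have "(b - a) - \<epsilon> < (b - a) * ((x - a) / ((x - a) + k * (b - x)))"
    using 1 by (simp add: less_divide_eq algebra_simps)
  then show ?thesis
    unfolding stretch_def a_def[symmetric] b_def[symmetric] k_def by (intro exI[of _ "(0, n)"]) simp
qed

text \<open>The infimum \<open>a\<close> is attained at some \<open>v\<close>. Since
  \<open>lower a\<close> is fixed by the monotone stretches, it bounds all values from below, and
  the copies of \<open>v\<close> come arbitrarily close to it.\<close>

lemma INF_stretch:
  assumes "finite W" "W \<noteq> {}" and f: "\<forall>w\<in>W. f w \<in> {0..1}"
  shows "(INF (w, q)\<in>W \<times> UNIV. stretch (ratio q) (f w)) = lower (INF w\<in>W. f w)"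
proof -
  define a where "a = (INF w\<in>W. f w)"
  have "a \<in> f ` W" unfolding a_def using assms(1,2) by (simp add: cInf_eq_Min)
  then obtain v where v: "v \<in> W" "a = f v" by blast
  have a: "a \<in> {0..1}" using v f by blast
  have ge: "lower a \<le> stretch (ratio q) (f w)" if "w \<in> W" for w q
  proof -
    have "lower a \<in> T" "lower a \<le> f w"
      using lower[of a] a INF_unit_le[OF f that] unfolding a_def by auto
    then show ?thesis
      using stretch_mono[of "lower a" "f w" "ratio q"] ratio_pos f that T_unit
      by (auto simp: stretch_fix)
  qed
  have "(INF (w, q)\<in>W \<times> UNIV. stretch (ratio q) (f w)) \<le> lower a"
  proof (rule field_le_epsilon)
    fix \<epsilon> :: real assume "0 < \<epsilon>"
    then obtain q where q: "stretch (ratio q) a < lower a + \<epsilon>" using stretch_near_lower a by blast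
    have "(INF (w, q)\<in>W \<times> UNIV. stretch (ratio q) (f w)) \<le> (case (v, q) of (w, q) \<Rightarrow> stretch (ratio q) (f w))"
      using v stretch_range ratio_pos f by (intro INF_unit_le) auto
    then show "(INF (w, q)\<in>W \<times> UNIV. stretch (ratio q) (f w)) \<le> lower a + \<epsilon>" using q v by simp
  qed
  moreover have "lower a \<le> (INF (w, q)\<in>W \<times> UNIV. stretch (ratio q) (f w))"
    using assms(2) ge by (intro cINF_greatest) auto
  ultimately show ?thesis unfolding a_def by simp
qed

lemma SUP_stretch:
  assumes "finite W" "W \<noteq> {}" and f: "\<forall>w\<in>W. f w \<in> {0..1}"
  shows "(SUP (w, q)\<in>W \<times> UNIV. stretch (ratio q) (f w)) = upper (SUP w\<in>W. f w)"
proof -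
  define a where "a = (SUP w\<in>W. f w)"
  have "a \<in> f ` W" unfolding a_def using assms(1,2) by (simp add: cSup_eq_Max)
  then obtain v where v: "v \<in> W" "a = f v" by blast
  have a: "a \<in> {0..1}" using v f by blast
  have le: "stretch (ratio q) (f w) \<le> upper a" if "w \<in> W" for w q
  proof -
    have "upper a \<in> T" "f w \<le> upper a"
      using upper[of a] a le_SUP_unit[OF f that] unfolding a_def by auto
    then show ?thesis
      using stretch_mono[of "f w" "upper a" "ratio q"] ratio_pos f that T_unit
      by (auto simp: stretch_fix)
  qed
  have "upper a \<le> (SUP (w, q)\<in>W \<times> UNIV. stretch (ratio q) (f w))"
  proof (rule field_le_epsilon)
    fix \<epsilon> :: real assume "0 < \<epsilon>"
    then obtain q where q: "upper a - \<epsilon> < stretch (ratio q) a" using stretch_near_upper a by blast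
    have "(case (v, q) of (w, q) \<Rightarrow> stretch (ratio q) (f w)) \<le> (SUP (w, q)\<in>W \<times> UNIV. stretch (ratio q) (f w))"
      using v stretch_range ratio_pos f by (intro le_SUP_unit) auto
    then show "upper a \<le> (SUP (w, q)\<in>W \<times> UNIV. stretch (ratio q) (f w)) + \<epsilon>" using q v by simp
  qed
  moreover have "(SUP (w, q)\<in>W \<times> UNIV. stretch (ratio q) (f w)) \<le> upper a"
    using assms(2) le by (intro cSUP_least) auto
  ultimately show ?thesis unfolding a_def by simp
qed

section \<open>The model of stretched copies\<close>

lemma PiGF_eval_range:
  assumes M: "PiG_model W \<pi> e" and "w \<in> W"
  shows "PiGF_eval W \<pi> T e w \<phi> \<in> {0..1}"
  using assms(2)
proof (induction \<phi> arbitrary: w)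
  case (Var p) then show ?case using M by (simp add: PiG_model_def)
next
  case (And \<phi> \<psi>) then show ?case unfolding PiGF_eval.simps by (blast intro: min_range)
next
  case (Imp \<phi> \<psi>) then show ?case unfolding PiGF_eval.simps by (blast intro: godel_imp_range)
next
  case (Box \<phi>)
  then have "(INF v\<in>W. godel_imp (\<pi> v) (PiGF_eval W \<pi> T e v \<phi>)) \<in> {0..1}"
    by (intro INF_unit_range) (blast intro: godel_imp_range, auto)
  then show ?case unfolding PiGF_eval.simps lower_def[symmetric] using lower(1) T_unit
    by (meson atLeastAtMost_iff subsetD)
next
  case (Dia \<phi>)
  then have "(SUP v\<in>W. min (\<pi> v) (PiGF_eval W \<pi> T e v \<phi>)) \<in> {0..1}"
    using M unfolding PiG_model_def by (intro SUP_unit_range) (blast intro: min_range, auto)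
  then show ?case unfolding PiGF_eval.simps upper_def[symmetric] using upper(1) T_unit
    by (meson atLeastAtMost_iff subsetD)
qed auto

text \<open>The world \<open>(w, q)\<close> is the copy of \<open>w\<close> with parameter
  \<open>q\<close>. \<open>\<pi>\<close> is distorted along with \<open>e\<close>, since the modal
  clauses compare it with formula values at the same world.\<close>

definition stretch_pi :: "('w \<Rightarrow> real) \<Rightarrow> 'w \<times> nat \<times> nat \<Rightarrow> real" where
  "stretch_pi \<pi> = (\<lambda>(w, q). stretch (ratio q) (\<pi> w))"

definition stretch_val :: "('w \<Rightarrow> 'p \<Rightarrow> real) \<Rightarrow> 'w \<times> nat \<times> nat \<Rightarrow> 'p \<Rightarrow> real" where
  "stretch_val e = (\<lambda>(w, q) p. stretch (ratio q) (e w p))"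

lemma PiG_model_stretch:
  "PiG_model W \<pi> e \<Longrightarrow> PiG_model (W \<times> UNIV) (stretch_pi \<pi>) (stretch_val e)"
  unfolding PiG_model_def stretch_pi_def stretch_val_def using stretch_range ratio_pos by auto

text \<open>Stretches commute with the connectives, and also with the operation under each infimum
  or supremum, so \<open>INF_stretch\<close> and \<open>SUP_stretch\<close> turn the exact modal
  clauses into the rounded ones.\<close>

lemma PiG_eval_stretch:
  assumes M: "PiG_model W \<pi> e" and "finite W" and "w \<in> W"
  shows "PiG_eval (W \<times> UNIV) (stretch_pi \<pi>) (stretch_val e) (w, q) \<phi> =
    stretch (ratio q) (PiGF_eval W \<pi> T e w \<phi>)"
  using assms(3)
proof (induction \<phi> arbitrary: w q)
  case (Var p) then show ?case by (simp add: stretch_val_def)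
next
  case Bot show ?case by (simp add: stretch_fix ends)
next
  case (And \<phi> \<psi>)
  then show ?case by (simp add: stretch_min PiGF_eval_range[OF M] ratio_pos del: atLeastAtMost_iff)
next
  case (Imp \<phi> \<psi>)
  then show ?case by (simp add: stretch_godel_imp PiGF_eval_range[OF M] ratio_pos del: atLeastAtMost_iff)
next
  case (Box \<phi>)
  let ?f = "\<lambda>v. godel_imp (\<pi> v) (PiGF_eval W \<pi> T e v \<phi>)"
  have f: "\<forall>v\<in>W. ?f v \<in> {0..1}" using PiGF_eval_range[OF M] godel_imp_range by blast
  have "godel_imp (stretch_pi \<pi> u) (PiG_eval (W \<times> UNIV) (stretch_pi \<pi>) (stretch_val e) u \<phi>)
      = (case u of (v, q) \<Rightarrow> stretch (ratio q) (?f v))" if "u \<in> W \<times> UNIV" for u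
    using that Box.IH M
    by (auto simp: stretch_pi_def PiG_model_def stretch_godel_imp PiGF_eval_range[OF M] ratio_pos
        simp del: atLeastAtMost_iff)
  then have "PiG_eval (W \<times> UNIV) (stretch_pi \<pi>) (stretch_val e) (w, q) (Box \<phi>)
      = (INF (v, q)\<in>W \<times> UNIV. stretch (ratio q) (?f v))"
    unfolding PiG_eval.simps by (intro INF_cong) auto
  also have "\<dots> = lower (INF v\<in>W. ?f v)" using Box.prems \<open>finite W\<close> f by (intro INF_stretch) auto
  \<comment> \<open>The rounded value is in \<open>T\<close>, so every copy fixes it; this matches a
    modal value being the same at all copies.\<close>
  also have "\<dots> = stretch (ratio q) (lower (INF v\<in>W. ?f v))"
    using INF_unit_range[OF f] Box.prems lower(1) by (subst stretch_fix) auto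
  finally show ?case by (simp add: lower_def)
next
  case (Dia \<phi>)
  let ?f = "\<lambda>v. min (\<pi> v) (PiGF_eval W \<pi> T e v \<phi>)"
  have f: "\<forall>v\<in>W. ?f v \<in> {0..1}"
    using PiGF_eval_range[OF M] M min_range unfolding PiG_model_def by blast
  have "min (stretch_pi \<pi> u) (PiG_eval (W \<times> UNIV) (stretch_pi \<pi>) (stretch_val e) u \<phi>)
      = (case u of (v, q) \<Rightarrow> stretch (ratio q) (?f v))" if "u \<in> W \<times> UNIV" for u
    using that Dia.IH M
    by (auto simp: stretch_pi_def PiG_model_def stretch_min PiGF_eval_range[OF M] ratio_pos
        simp del: atLeastAtMost_iff)
  then have "PiG_eval (W \<times> UNIV) (stretch_pi \<pi>) (stretch_val e) (w, q) (Dia \<phi>)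
      = (SUP (v, q)\<in>W \<times> UNIV. stretch (ratio q) (?f v))"
    unfolding PiG_eval.simps by (intro SUP_cong) auto
  also have "\<dots> = upper (SUP v\<in>W. ?f v)" using Dia.prems \<open>finite W\<close> f by (intro SUP_stretch) auto
  also have "\<dots> = stretch (ratio q) (upper (SUP v\<in>W. ?f v))"
    using SUP_unit_range[OF f] Dia.prems upper(1) by (subst stretch_fix) auto
  finally show ?case by (simp add: upper_def)
qed

end

section \<open>Countermodels over arbitrary infinite types\<close>

text \<open>An injection of the naturals into \<open>'w\<close> has a left inverse onto the
  naturals, which is followed by an enumeration of \<open>A\<close>.\<close>

lemma infinite_surj_countable:
  assumes "infinite (UNIV :: 'w set)" "countable A" "A \<noteq> {}"
  obtains g :: "'w \<Rightarrow> 'a" where "range g = A"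
proof -
  obtain h :: "nat \<Rightarrow> 'w" where "inj h" using infinite_countable_subset[OF assms(1)] by blast
  then have "range (from_nat_into A \<circ> inv h) = A"
    using range_from_nat_into[OF assms(3,2)] inj_imp_surj_inv by (metis image_comp)
  then show ?thesis using that by blast
qed

lemma PiG_countermodel:
  fixes W :: "'u set"
  assumes inf: "infinite (UNIV :: 'w set)" and M: "PiGF_model W \<pi> T e" and "finite W" "w \<in> W"
    and "PiGF_eval W \<pi> T e w \<phi> \<noteq> 1"
  shows "\<not> PiG_tautology TYPE('w) \<phi>"
proof -
  interpret grid T using M by unfold_locales (auto simp: PiGF_model_def)
  have MG: "PiG_model W \<pi> e" using M by (simp add: PiGF_model_def)
  have v: "PiGF_eval W \<pi> T e w \<phi> \<in> {0..1}" by (rule PiGF_eval_range) fact+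
  \<comment> \<open>An arbitrary copy: each stretch fixes 1 and is strictly increasing, so a value
    below 1 stays below 1.\<close>
  let ?q = "(0, 0) :: nat \<times> nat"
  have "PiGF_eval W \<pi> T e w \<phi> < 1" using v assms(5) by auto
  then have "stretch (ratio ?q) (PiGF_eval W \<pi> T e w \<phi>) < stretch (ratio ?q) 1"
    using v ratio_pos by (intro stretch_strict_mono) auto
  then have ne: "PiG_eval (W \<times> UNIV) (stretch_pi \<pi>) (stretch_val e) (w, ?q) \<phi> \<noteq> 1"
    by (simp add: PiG_eval_stretch[OF MG \<open>finite W\<close> \<open>w \<in> W\<close>] stretch_fix ends)
  have "countable (W \<times> (UNIV :: (nat \<times> nat) set))" "W \<times> (UNIV :: (nat \<times> nat) set) \<noteq> {}"
    using assms(3,4) by (auto intro: countable_finite)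
  \<comment> \<open>Elements of \<open>'w\<close> may name the same world repeatedly; by
    \<open>PiG_eval_reindex\<close> this leaves all values unchanged.\<close>
  then obtain g :: "'w \<Rightarrow> 'u \<times> nat \<times> nat" where g: "range g = W \<times> UNIV"
    by (rule infinite_surj_countable[OF inf])
  then obtain u where "g u = (w, ?q)" using \<open>w \<in> W\<close> by (metis UNIV_I mem_Sigma_iff rangeE)
  then have "PiG_eval UNIV (stretch_pi \<pi> \<circ> g) (stretch_val e \<circ> g) u \<phi> \<noteq> 1"
    using ne by (simp add: PiG_eval_reindex g)
  moreover have "PiG_model UNIV (stretch_pi \<pi> \<circ> g) (stretch_val e \<circ> g)"
    using PiG_model_stretch[OF MG] by (intro PiG_model_reindex) (simp add: g)
  ultimately show ?thesis unfolding PiG_tautology_def PiG_valid_def by blast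
qed

theorem theorem5p1:
  fixes \<phi> :: "('p::countable) fm"
  assumes "infinite (UNIV :: 'w set)" and "infinite (UNIV :: 'u set)"
  shows "PiG_tautology TYPE('w) \<phi> \<longleftrightarrow>
    (\<forall>(W :: 'u set) \<pi> T e.
       PiGF_model W \<pi> T e \<and> finite W \<and> card W + card T \<le> 2 * (fm_length \<phi> + 2)
       \<longrightarrow> PiGF_valid W \<pi> T e \<phi>)"
proof
  assume taut: "PiG_tautology TYPE('w) \<phi>"
  show "\<forall>(W :: 'u set) \<pi> T e.
       PiGF_model W \<pi> T e \<and> finite W \<and> card W + card T \<le> 2 * (fm_length \<phi> + 2)
       \<longrightarrow> PiGF_valid W \<pi> T e \<phi>"
  proof (intro allI impI, elim conjE)
    fix W :: "'u set" and \<pi> T and e :: "'u \<Rightarrow> 'p \<Rightarrow> real"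
    assume "PiGF_model W \<pi> T e" "finite W"
    then show "PiGF_valid W \<pi> T e \<phi>"
      unfolding PiGF_valid_def using PiG_countermodel[OF assms(1), of W \<pi> T e _ \<phi>] taut by metis
  qed
next
  assume small: "\<forall>(W :: 'u set) \<pi> T e.
       PiGF_model W \<pi> T e \<and> finite W \<and> card W + card T \<le> 2 * (fm_length \<phi> + 2)
       \<longrightarrow> PiGF_valid W \<pi> T e \<phi>"
  have "PiG_eval W \<pi> e w \<phi> = 1" if M: "PiG_model W \<pi> e" and w: "w \<in> W"
    for W :: "'w set" and \<pi> e w
  proof -
    obtain V T where V: "V \<subseteq> W" "finite V" "w \<in> V" "PiGF_model V \<pi> T e"
      "card V + card T \<le> 2 * (fm_length \<phi> + 2)"
      "PiGF_eval V \<pi> T e w \<phi> = PiG_eval W \<pi> e w \<phi>"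
      by (rule small_PiGF_countermodel[OF M w, of \<phi>])
    \<comment> \<open>The small countermodel still lives in \<open>'w\<close>; it is moved along a
      bijection to an equally large set in \<open>'u\<close>, which preserves the size
      bound.\<close>
    obtain U :: "'u set" where U: "finite U" "card U = card V"
      using infinite_arbitrarily_large[OF assms(2)] by blast
    then obtain g where g: "bij_betw g U V" using V(2) finite_same_card_bij by blast
    then have im: "g ` U = V" by (simp add: bij_betw_def)
    then obtain u where u: "u \<in> U" "g u = w" using V(3) by blast
    have "PiGF_model U (\<pi> \<circ> g) T (e \<circ> g)"
      using V(4) PiG_model_reindex[of g U] by (auto simp: PiGF_model_def im)
    then have "PiGF_valid U (\<pi> \<circ> g) T (e \<circ> g) \<phi>" using small U V(5) by auto
    then have "PiGF_eval V \<pi> T e w \<phi> = 1"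
      using u by (auto simp: PiGF_valid_def PiGF_eval_reindex im)
    then show ?thesis using V(6) by simp
  qed
  then show "PiG_tautology TYPE('w) \<phi>" by (simp add: PiG_tautology_def PiG_valid_def)
qed

end
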